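(* Let $\mathcal{C},\mathcal{X},\mathcal{B},\mathcal{D}\in\mathbb{C}^{\mathbf{N}(n)\times\mathbf{N}(n)}$. Then the tensor equation $\mathcal{C}*_n\mathcal{X}*_n\mathcal{D}=\mathcal{B}$ (in the unknown $\mathcal{X}$): (a) is solvable if and only if there exist $\mathcal{C}^{\mathrm{core}}$ and $\mathcal{D}^{\mathrm{core}}$ such that $$\mathcal{C}*_n\mathcal{C}^{\mathrm{core}}*_n\mathcal{B}*_n\mathcal{D}^{\mathrm{core}}*_n\mathcal{D}=\mathcal{B};$$ (b) in this case, the general solution is $$\mathcal{X}=\mathcal{C}^{\mathrm{core}}*_n\mathcal{B}*_n\mathcal{D}^{\mathrm{core}}+\mathcal{Z}-\mathcal{C}^{\mathrm{core}}*_n\mathcal{C}*_n\mathcal{Z}*_n\mathcal{D}*_n\mathcal{D}^{\mathrm{core}},$$ where $\mathcal{Z}\in\mathbb{C}^{\mathbf{N}(n)\times\mathbf{N}(n)}$ is an arbitrary tensor.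
   Context: Here $\mathbf{N}(n)=N_1\times\cdots\times N_n$, and $\mathbb{C}^{\mathbf{N}(n)\times\mathbf{N}(n)}$ is the set of complex tensors $\mathcal{A}=(a_{i_1\ldots i_n j_1\ldots j_n})$ with $1\le i_k,j_k\le N_k$. The Einstein product is $(\mathcal{A}*_n\mathcal{B})_{i_1\ldots i_n j_1\ldots j_n}=\sum_{k_1,\ldots,k_n}a_{i_1\ldots i_n k_1\ldots k_n}b_{k_1\ldots k_n j_1\ldots j_n}$, powers are taken with respect to $*_n$, and $\mathcal{A}^*$ is the conjugate transpose (swap the first $n$ and last $n$ indices and conjugate). The core inverse of $\mathcal{A}\in\mathbb{C}^{\mathbf{N}(n)\times\mathbf{N}(n)}$, denoted $\mathcal{A}^{\mathrm{core}}$, is a tensor $\mathcal{Y}\in\mathbb{C}^{\mathbf{N}(n)\times\mathbf{N}(n)}$ satisfying $(\mathcal{A}*_n\mathcal{Y})^*=\mathcal{A}*_n\mathcal{Y}$, $\mathcal{Y}*_n\mathcal{A}^2=\mathcal{A}$ and $\mathcal{A}*_n\mathcal{Y}^2=\mathcal{Y}$; it is unique whenever it exists. "General solution" means that every tensor of the displayed form is a solution and every solution is of that form.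
   Formalization: The core inverses of C and D are assumed to exist; without this, "solvable only if" in (a) fails, e.g. n=1, N_1=2, C=E_12, D=I, B=0, where X=0 is a solution but C has no core inverse. *)

theory Defs
  imports Complex_Main "HOL-Library.FuncSet" "HOL-Library.Function_Algebras"
begin

type_synonym multi_index = "nat \<Rightarrow> nat"
type_synonym ctensor = "multi_index \<Rightarrow> multi_index \<Rightarrow> complex"

text \<open>
  The dimensions \<open>N 1, \<dots>, N n\<close> are given by a function \<open>N\<close>, of which only the values on
  \<open>{1..n}\<close> matter.  A multi-index \<open>(i 1, \<dots>, i n)\<close> is a function that is extensional on \<open>{1..n}\<close>.
\<close>

definition multi_indices :: "nat \<Rightarrow> (nat \<Rightarrow> nat) \<Rightarrow> multi_index set" where
  "multi_indices n N = (\<Pi>\<^sub>E k\<in>{1..n}. {1..N k})"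

text \<open>
  The entry \<open>a\<close> with subscripts \<open>i 1, \<dots>, i n, j 1, \<dots>, j n\<close> is \<open>A i j\<close>.  Entries outside the index
  range are fixed to be \<open>0\<close>, so that equality of tensors is equality of functions and the
  pointwise \<open>+\<close> and \<open>-\<close> on functions are the tensor operations.
\<close>

definition tensors :: "nat \<Rightarrow> (nat \<Rightarrow> nat) \<Rightarrow> ctensor set" where
  "tensors n N =
     {A. \<forall>i j. i \<notin> multi_indices n N \<or> j \<notin> multi_indices n N \<longrightarrow> A i j = 0}"

definition einstein_prod :: "nat \<Rightarrow> (nat \<Rightarrow> nat) \<Rightarrow> ctensor \<Rightarrow> ctensor \<Rightarrow> ctensor" where
  "einstein_prod n N A B = (\<lambda>i j. \<Sum>k\<in>multi_indices n N. A i k * B k j)"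

abbreviation einstein_prod_infix
    :: "ctensor \<Rightarrow> nat \<Rightarrow> (nat \<Rightarrow> nat) \<Rightarrow> ctensor \<Rightarrow> ctensor"
    (\<open>(_ \<star>\<^bsub>_,_\<^esub>/ _)\<close> [70, 0, 0, 71] 70) where
  "A \<star>\<^bsub>n,N\<^esub> B \<equiv> einstein_prod n N A B"

definition conj_transpose :: "ctensor \<Rightarrow> ctensor" where
  "conj_transpose A = (\<lambda>i j. cnj (A j i))"

definition is_core_inverse :: "nat \<Rightarrow> (nat \<Rightarrow> nat) \<Rightarrow> ctensor \<Rightarrow> ctensor \<Rightarrow> bool" where
  "is_core_inverse n N A Y \<longleftrightarrow>
     Y \<in> tensors n N \<and>
     conj_transpose (A \<star>\<^bsub>n,N\<^esub> Y) = A \<star>\<^bsub>n,N\<^esub> Y \<and>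
     Y \<star>\<^bsub>n,N\<^esub> (A \<star>\<^bsub>n,N\<^esub> A) = A \<and>
     A \<star>\<^bsub>n,N\<^esub> (Y \<star>\<^bsub>n,N\<^esub> Y) = Y"

end

theory Submission
  imports Defs
begin

text \<open>
  The only property of core inverses that matters is that a core inverse \<open>Y\<close> of \<open>A\<close> is an inner
  inverse, \<open>A Y A = A\<close>.  It follows from \<open>Y A\<^sup>2 = A\<close> and \<open>A Y\<^sup>2 = Y\<close> by associativity alone
  (lemma \<open>core_inverse_inner\<close>).

  With inner inverses \<open>C'\<close> of \<open>C\<close> and \<open>D'\<close> of \<open>D\<close> this is Penrose's argument.  If \<open>C X D = B\<close>, then
  \<open>C C' B D' D = (C C' C) X (D D' D) = B\<close>.  Conversely, if \<open>C C' B D' D = B\<close>, then \<open>C' B D'\<close> is a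
  solution, and adding \<open>Z - C' C Z D D'\<close> preserves solutions, because \<open>C (C' C Z D D') D = C Z D\<close>.
  Every solution \<open>X\<close> arises in this way from \<open>Z = X\<close>, since then \<open>C' B D' = C' C X D D'\<close>.
\<close>

lemma einstein_prod_assoc:
  "A \<star>\<^bsub>n,N\<^esub> B \<star>\<^bsub>n,N\<^esub> C = A \<star>\<^bsub>n,N\<^esub> (B \<star>\<^bsub>n,N\<^esub> C)"
proof (intro ext)
  fix i j
  let ?I = "multi_indices n N"
  have "(A \<star>\<^bsub>n,N\<^esub> B \<star>\<^bsub>n,N\<^esub> C) i j = (\<Sum>l\<in>?I. \<Sum>k\<in>?I. A i k * B k l * C l j)"
    by (simp add: einstein_prod_def sum_distrib_right)
  also have "\<dots> = (\<Sum>k\<in>?I. \<Sum>l\<in>?I. A i k * B k l * C l j)"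
    by (rule sum.swap)
  also have "\<dots> = (A \<star>\<^bsub>n,N\<^esub> (B \<star>\<^bsub>n,N\<^esub> C)) i j"
    by (simp add: einstein_prod_def sum_distrib_left mult.assoc)
  finally show "(A \<star>\<^bsub>n,N\<^esub> B \<star>\<^bsub>n,N\<^esub> C) i j = (A \<star>\<^bsub>n,N\<^esub> (B \<star>\<^bsub>n,N\<^esub> C)) i j" .
qed

lemma einstein_prod_add_left: "(A + B) \<star>\<^bsub>n,N\<^esub> C = A \<star>\<^bsub>n,N\<^esub> C + B \<star>\<^bsub>n,N\<^esub> C"
  by (intro ext) (simp add: einstein_prod_def sum.distrib distrib_right)

lemma einstein_prod_add_right: "A \<star>\<^bsub>n,N\<^esub> (B + C) = A \<star>\<^bsub>n,N\<^esub> B + A \<star>\<^bsub>n,N\<^esub> C"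
  by (intro ext) (simp add: einstein_prod_def sum.distrib distrib_left)

lemma einstein_prod_diff_left: "(A - B) \<star>\<^bsub>n,N\<^esub> C = A \<star>\<^bsub>n,N\<^esub> C - B \<star>\<^bsub>n,N\<^esub> C"
  by (intro ext) (simp add: einstein_prod_def sum_subtractf left_diff_distrib)

lemma einstein_prod_diff_right: "A \<star>\<^bsub>n,N\<^esub> (B - C) = A \<star>\<^bsub>n,N\<^esub> B - A \<star>\<^bsub>n,N\<^esub> C"
  by (intro ext) (simp add: einstein_prod_def sum_subtractf right_diff_distrib)

lemma einstein_prod_in_tensors:
  assumes "A \<in> tensors n N" and "B \<in> tensors n N"
  shows "A \<star>\<^bsub>n,N\<^esub> B \<in> tensors n N"
  using assms by (auto simp: tensors_def einstein_prod_def intro!: sum.neutral)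

lemma add_in_tensors:
  assumes "A \<in> tensors n N" and "B \<in> tensors n N"
  shows "A + B \<in> tensors n N"
  using assms by (simp add: tensors_def)

lemma diff_in_tensors:
  assumes "A \<in> tensors n N" and "B \<in> tensors n N"
  shows "A - B \<in> tensors n N"
  using assms by (simp add: tensors_def)

lemma core_inverse_inner:
  assumes "is_core_inverse n N A Y"
  shows "A \<star>\<^bsub>n,N\<^esub> (Y \<star>\<^bsub>n,N\<^esub> A) = A"
proof -
  have yaa: "Y \<star>\<^bsub>n,N\<^esub> (A \<star>\<^bsub>n,N\<^esub> A) = A" and ayy: "A \<star>\<^bsub>n,N\<^esub> (Y \<star>\<^bsub>n,N\<^esub> Y) = Y"
    using assms by (auto simp: is_core_inverse_def)
  \<comment> \<open>Both sides of the claim equal \<open>A Y\<^sup>2 A\<^sup>2\<close>.\<close>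
  have "A \<star>\<^bsub>n,N\<^esub> (Y \<star>\<^bsub>n,N\<^esub> A) = A \<star>\<^bsub>n,N\<^esub> (Y \<star>\<^bsub>n,N\<^esub> (Y \<star>\<^bsub>n,N\<^esub> (A \<star>\<^bsub>n,N\<^esub> A)))"
    by (simp only: yaa)
  also have "\<dots> = A \<star>\<^bsub>n,N\<^esub> (Y \<star>\<^bsub>n,N\<^esub> Y) \<star>\<^bsub>n,N\<^esub> (A \<star>\<^bsub>n,N\<^esub> A)"
    by (simp only: einstein_prod_assoc)
  also have "\<dots> = A"
    by (simp only: ayy yaa)
  finally show ?thesis .
qed

lemma core_inverse_inner_left:
  assumes "is_core_inverse n N A Y"
  shows "A \<star>\<^bsub>n,N\<^esub> (Y \<star>\<^bsub>n,N\<^esub> (A \<star>\<^bsub>n,N\<^esub> W)) = A \<star>\<^bsub>n,N\<^esub> W"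
  using core_inverse_inner[OF assms] by (metis einstein_prod_assoc)

theorem theorem5p5:
  fixes n :: nat and N :: "nat \<Rightarrow> nat" and C B D :: ctensor
  assumes "C \<in> tensors n N" and "B \<in> tensors n N" and "D \<in> tensors n N"
    and "\<exists>Y. is_core_inverse n N C Y" and "\<exists>Y. is_core_inverse n N D Y"
  shows "((\<exists>X\<in>tensors n N. C \<star>\<^bsub>n,N\<^esub> X \<star>\<^bsub>n,N\<^esub> D = B) \<longleftrightarrow>
          (\<exists>Cc Dc. is_core_inverse n N C Cc \<and> is_core_inverse n N D Dc \<and>
             C \<star>\<^bsub>n,N\<^esub> Cc \<star>\<^bsub>n,N\<^esub> B \<star>\<^bsub>n,N\<^esub> Dc \<star>\<^bsub>n,N\<^esub> D = B)) \<and>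
         (\<forall>Cc Dc. is_core_inverse n N C Cc \<and> is_core_inverse n N D Dc \<and>
             C \<star>\<^bsub>n,N\<^esub> Cc \<star>\<^bsub>n,N\<^esub> B \<star>\<^bsub>n,N\<^esub> Dc \<star>\<^bsub>n,N\<^esub> D = B \<longrightarrow>
            {X \<in> tensors n N. C \<star>\<^bsub>n,N\<^esub> X \<star>\<^bsub>n,N\<^esub> D = B} =
            {Cc \<star>\<^bsub>n,N\<^esub> B \<star>\<^bsub>n,N\<^esub> Dc + Z
               - Cc \<star>\<^bsub>n,N\<^esub> C \<star>\<^bsub>n,N\<^esub> Z \<star>\<^bsub>n,N\<^esub> D \<star>\<^bsub>n,N\<^esub> Dc | Z. Z \<in> tensors n N})"
proof (intro conjI allI impI iffI)
  assume "\<exists>X\<in>tensors n N. C \<star>\<^bsub>n,N\<^esub> X \<star>\<^bsub>n,N\<^esub> D = B"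
  then obtain X where X: "C \<star>\<^bsub>n,N\<^esub> X \<star>\<^bsub>n,N\<^esub> D = B" by blast
  obtain Cc Dc where core: "is_core_inverse n N C Cc" "is_core_inverse n N D Dc"
    using assms by blast
  have "C \<star>\<^bsub>n,N\<^esub> Cc \<star>\<^bsub>n,N\<^esub> B \<star>\<^bsub>n,N\<^esub> Dc \<star>\<^bsub>n,N\<^esub> D = B"
    unfolding X[symmetric]
    by (simp add: einstein_prod_assoc core_inverse_inner_left[OF core(1)]
        core_inverse_inner[OF core(2)])
  with core show "\<exists>Cc Dc. is_core_inverse n N C Cc \<and> is_core_inverse n N D Dc \<and>
      C \<star>\<^bsub>n,N\<^esub> Cc \<star>\<^bsub>n,N\<^esub> B \<star>\<^bsub>n,N\<^esub> Dc \<star>\<^bsub>n,N\<^esub> D = B" by blast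
next
  assume "\<exists>Cc Dc. is_core_inverse n N C Cc \<and> is_core_inverse n N D Dc \<and>
      C \<star>\<^bsub>n,N\<^esub> Cc \<star>\<^bsub>n,N\<^esub> B \<star>\<^bsub>n,N\<^esub> Dc \<star>\<^bsub>n,N\<^esub> D = B"
  then obtain Cc Dc where core: "is_core_inverse n N C Cc" "is_core_inverse n N D Dc"
    and B: "C \<star>\<^bsub>n,N\<^esub> Cc \<star>\<^bsub>n,N\<^esub> B \<star>\<^bsub>n,N\<^esub> Dc \<star>\<^bsub>n,N\<^esub> D = B" by blast
  show "\<exists>X\<in>tensors n N. C \<star>\<^bsub>n,N\<^esub> X \<star>\<^bsub>n,N\<^esub> D = B"
  proof
    show "C \<star>\<^bsub>n,N\<^esub> (Cc \<star>\<^bsub>n,N\<^esub> B \<star>\<^bsub>n,N\<^esub> Dc) \<star>\<^bsub>n,N\<^esub> D = B"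
      using B by (simp add: einstein_prod_assoc)
    show "Cc \<star>\<^bsub>n,N\<^esub> B \<star>\<^bsub>n,N\<^esub> Dc \<in> tensors n N"
      using core assms(2) by (simp add: is_core_inverse_def einstein_prod_in_tensors)
  qed
next
  fix Cc Dc
  assume hyp: "is_core_inverse n N C Cc \<and> is_core_inverse n N D Dc \<and>
      C \<star>\<^bsub>n,N\<^esub> Cc \<star>\<^bsub>n,N\<^esub> B \<star>\<^bsub>n,N\<^esub> Dc \<star>\<^bsub>n,N\<^esub> D = B"
  then have core: "is_core_inverse n N C Cc" "is_core_inverse n N D Dc"
    and B: "C \<star>\<^bsub>n,N\<^esub> (Cc \<star>\<^bsub>n,N\<^esub> (B \<star>\<^bsub>n,N\<^esub> (Dc \<star>\<^bsub>n,N\<^esub> D))) = B"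
    by (auto simp: einstein_prod_assoc)
  have tens: "Cc \<in> tensors n N" "Dc \<in> tensors n N"
    using core by (auto simp: is_core_inverse_def)
  let ?sol = "\<lambda>Z. Cc \<star>\<^bsub>n,N\<^esub> B \<star>\<^bsub>n,N\<^esub> Dc + Z
      - Cc \<star>\<^bsub>n,N\<^esub> C \<star>\<^bsub>n,N\<^esub> Z \<star>\<^bsub>n,N\<^esub> D \<star>\<^bsub>n,N\<^esub> Dc"
  show "{X \<in> tensors n N. C \<star>\<^bsub>n,N\<^esub> X \<star>\<^bsub>n,N\<^esub> D = B} = {?sol Z | Z. Z \<in> tensors n N}"
  proof (intro equalityI subsetI)
    fix X
    assume "X \<in> {X \<in> tensors n N. C \<star>\<^bsub>n,N\<^esub> X \<star>\<^bsub>n,N\<^esub> D = B}"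
    then have X: "X \<in> tensors n N" and eq: "C \<star>\<^bsub>n,N\<^esub> X \<star>\<^bsub>n,N\<^esub> D = B" by auto
    have "X = ?sol X"
      unfolding eq[symmetric] by (simp add: einstein_prod_assoc)
    with X show "X \<in> {?sol Z | Z. Z \<in> tensors n N}" by blast
  next
    fix X
    assume "X \<in> {?sol Z | Z. Z \<in> tensors n N}"
    then obtain Z where Z: "Z \<in> tensors n N" and X: "X = ?sol Z" by blast
    have "X \<in> tensors n N"
      unfolding X using Z tens assms
      by (intro diff_in_tensors add_in_tensors einstein_prod_in_tensors)
    moreover have "C \<star>\<^bsub>n,N\<^esub> X \<star>\<^bsub>n,N\<^esub> D = B"
      unfolding X
      by (simp add: einstein_prod_add_left einstein_prod_add_right einstein_prod_diff_left
          einstein_prod_diff_right einstein_prod_assoc B core_inverse_inner_left[OF core(1)]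
          core_inverse_inner[OF core(2)])
    ultimately show "X \<in> {X \<in> tensors n N. C \<star>\<^bsub>n,N\<^esub> X \<star>\<^bsub>n,N\<^esub> D = B}" by blast
  qed
qed

end
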